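(* The quotient space $C_M=[-1,1]^2/\!\sim_{CM}$ (with the quotient topology) and the surface $M\subset\mathbb{R}^3$ (with the subspace topology) are homeomorphic.
   Context: On the square $[-1,1]^2$ (fundamental polygon of the Möbius strip) the equivalence relation $\sim_{CM}$ is defined by: $(t,v)\sim_{CM}(t',v')$ if and only if either $v\in\{-1,1\}$ and $(t',v')\in\{(t,v),(-t,-v)\}$, or $v\notin\{-1,1\}$ and $(t',v')=(t,v)$. The map $m:[-1,1]^2\to\mathbb{R}^3$ is defined by $$m(t,v)=\Big(\big(1+\tfrac t2\cos\tfrac{v\pi}{2}\big)\cos(v\pi),\ \big(1+\tfrac t2\cos\tfrac{v\pi}{2}\big)\sin(v\pi),\ \tfrac t2\sin\tfrac{v\pi}{2}\Big),$$ and $M=m([-1,1]^2)$ is its image. *)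

theory Defs
  imports "HOL-Analysis.Analysis"
begin

definition quotient_topology :: "'a topology \<Rightarrow> ('a \<times> 'a) set \<Rightarrow> 'a set topology" where
  "quotient_topology X r =
     topology (\<lambda>U. U \<subseteq> topspace X // r \<and> openin X {x \<in> topspace X. r `` {x} \<in> U})"

lemma openin_quotient_topology:
  "openin (quotient_topology X r) U \<longleftrightarrow>
     U \<subseteq> topspace X // r \<and> openin X {x \<in> topspace X. r `` {x} \<in> U}"
proof -
  have "istopology (\<lambda>U. U \<subseteq> topspace X // r \<and> openin X {x \<in> topspace X. r `` {x} \<in> U})"
    unfolding istopology_def
  proof (rule conjI; intro allI impI conjI)
    fix S T
    assume S: "S \<subseteq> topspace X // r \<and> openin X {x \<in> topspace X. r `` {x} \<in> S}"
      and T: "T \<subseteq> topspace X // r \<and> openin X {x \<in> topspace X. r `` {x} \<in> T}"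
    then show "S \<inter> T \<subseteq> topspace X // r" by blast
    have "{x \<in> topspace X. r `` {x} \<in> S \<inter> T} =
        {x \<in> topspace X. r `` {x} \<in> S} \<inter> {x \<in> topspace X. r `` {x} \<in> T}" by blast
    then show "openin X {x \<in> topspace X. r `` {x} \<in> S \<inter> T}"
      using S T by (simp only: openin_Int)
  next
    fix K
    assume K: "\<forall>S\<in>K. S \<subseteq> topspace X // r \<and> openin X {x \<in> topspace X. r `` {x} \<in> S}"
    then show "\<Union>K \<subseteq> topspace X // r" by blast
    have "{x \<in> topspace X. r `` {x} \<in> \<Union>K} =
        (\<Union>S\<in>K. {x \<in> topspace X. r `` {x} \<in> S})" by blast
    moreover have "openin X (\<Union>S\<in>K. {x \<in> topspace X. r `` {x} \<in> S})"
      by (rule openin_Union) (use K in blast)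
    ultimately show "openin X {x \<in> topspace X. r `` {x} \<in> \<Union>K}"
      by (simp only:)
  qed
  then show ?thesis
    by (simp add: quotient_topology_def topology_inverse')
qed

lemma topspace_quotient_topology [simp]:
  "topspace (quotient_topology X r) = topspace X // r"
proof -
  have "{x \<in> topspace X. r `` {x} \<in> topspace X // r} = topspace X"
    by (auto intro: quotientI)
  then have "openin (quotient_topology X r) (topspace X // r)"
    by (simp add: openin_quotient_topology)
  then show ?thesis
    by (metis openin_quotient_topology openin_subset openin_topspace subset_antisym)
qed

lemma quotient_map_quotient_topology:
  "quotient_map X (quotient_topology X r) (\<lambda>x. r `` {x})"
  by (auto simp: quotient_map_def openin_quotient_topology quotient_def)

definition square :: "(real \<times> real) set" where
  "square = {-1..1} \<times> {-1..1}"

definition CM_rel :: "((real \<times> real) \<times> (real \<times> real)) set" where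
  "CM_rel = {((t, v), (t', v')). (t, v) \<in> square \<and> (t', v') \<in> square \<and>
     (v \<in> {-1, 1} \<and> (t', v') \<in> {(t, v), (-t, -v)} \<or>
      v \<notin> {-1, 1} \<and> (t', v') = (t, v))}"

lemma equiv_CM_rel: "equiv square CM_rel"
  by (rule equivI) (auto simp: refl_on_def sym_def trans_def CM_rel_def square_def)

definition C_M :: "(real \<times> real) set topology" where
  "C_M = quotient_topology (top_of_set square) CM_rel"

definition moebius_map :: "real \<times> real \<Rightarrow> real ^ 3" where
  "moebius_map = (\<lambda>(t, v). vector
     [(1 + t / 2 * cos (v * pi / 2)) * cos (v * pi),
      (1 + t / 2 * cos (v * pi / 2)) * sin (v * pi),
      t / 2 * sin (v * pi / 2)])"

definition moebius_surface :: "(real ^ 3) set" where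
  "moebius_surface = moebius_map ` square"

end

theory Submission
  imports Defs
begin

text \<open>
  The parametrisation \<open>m\<close> of the strip is a continuous map from a compact space onto a
  Hausdorff space, hence closed, hence a quotient map onto \<open>M\<close>; the canonical projection
  onto \<open>C\<^sub>M\<close> is a quotient map by construction. Two quotient maps with the same
  domain and the same fibres have homeomorphic targets, so it remains to see that the fibres of
  \<open>m\<close> are exactly the \<open>CM\<close>-classes (\<open>moebius_map_eq_iff\<close>).

  The fibres are read off in cylindrical coordinates: \<open>m (t, v)\<close> has distance
  \<open>1 + t/2 cos (v\<pi>/2) \<ge> 1/2\<close> from the third axis and polar angle \<open>v\<pi>\<close>. So the image point
  determines \<open>v\<close> up to the ambiguity \<open>1\<close> versus \<open>-1\<close>, and then \<open>t\<close> through the point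
  \<open>t (cos (v\<pi>/2), sin (v\<pi>/2))\<close> of the half-plane at that angle. Passing from \<open>v = 1\<close> to
  \<open>v = -1\<close> turns the direction \<open>(0, 1)\<close> into \<open>(0, -1)\<close>, which is the sign change in the gluing.
\<close>

text \<open>
  Since \<open>g\<close> is constant on the fibres of \<open>f\<close>, it factors as \<open>h \<circ> f\<close> with \<open>h\<close> continuous. A right factor
  cancels from a quotient map, so \<open>h\<close> is itself a quotient map, and it is injective because the
  fibres of \<open>g\<close> are no larger than those of \<open>f\<close>.
\<close>

lemma homeomorphic_space_quotient_maps_same_fibres:
  assumes f: "quotient_map X Y f" and g: "quotient_map X Z g"
    and fibres: "\<And>x y. \<lbrakk>x \<in> topspace X; y \<in> topspace X\<rbrakk> \<Longrightarrow> f x = f y \<longleftrightarrow> g x = g y"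
  shows "Y homeomorphic_space Z"
proof -
  obtain h where h: "continuous_map Y Z h" "h ` topspace Y = g ` topspace X"
      "\<And>x. x \<in> topspace X \<Longrightarrow> h (f x) = g x"
    using quotient_map_lift_exists [OF f quotient_imp_continuous_map [OF g]] fibres by metis
  have "quotient_map X Z (h \<circ> f)"
    using quotient_map_eq [OF g, of "h \<circ> f"] h(3) by simp
  then have "quotient_map Y Z h"
    by (rule quotient_map_from_composition [OF quotient_imp_continuous_map [OF f] h(1)])
  moreover have "inj_on h (topspace Y)"
    unfolding quotient_imp_surjective_map [OF f, symmetric]
    using h(3) fibres by (auto simp: inj_on_def)
  ultimately show ?thesis
    using homeomorphic_map_def homeomorphic_map_imp_homeomorphic_space by blast
qed

lemma same_ray_imp_eq:
  fixes r s a b :: real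
  assumes "r > 0" "s > 0" "r * cos a = s * cos b" "r * sin a = s * sin b"
  shows "r = s" "cos a = cos b" "sin a = sin b"
proof -
  have sq: "(x * cos c)\<^sup>2 + (x * sin c)\<^sup>2 = x\<^sup>2" for x c :: real
    by (simp add: power_mult_distrib flip: distrib_left)
  have "r\<^sup>2 = s\<^sup>2"
    using sq [of r a] sq [of s b] assms(3,4) by simp
  with assms(1,2) show "r = s"
    by (simp add: power2_eq_iff_nonneg)
  with assms show "cos a = cos b" "sin a = sin b"
    by auto
qed

lemma moebius_radius_pos:
  assumes "(t, v) \<in> square"
  shows "1 + t / 2 * cos (v * pi / 2) > 0"
proof -
  have "\<bar>t * cos (v * pi / 2)\<bar> \<le> 1 * 1"
    unfolding abs_mult using assms by (intro mult_mono) (auto simp: square_def)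
  then show ?thesis by (simp add: abs_le_iff)
qed

lemma angle_eq_cases:
  fixes v w :: real
  assumes "cos (v * pi) = cos (w * pi)" "sin (v * pi) = sin (w * pi)"
    and "v \<in> {-1..1}" "w \<in> {-1..1}"
  shows "v = w \<or> v = 1 \<and> w = -1 \<or> v = -1 \<and> w = 1"
proof -
  obtain n :: int where "v * pi = w * pi + 2 * pi * n"
    using assms(1,2) sin_cos_eq_iff by blast
  then have "v * pi = (w + 2 * n) * pi" by (simp add: algebra_simps)
  then have n: "v = w + 2 * n" by simp
  with assms(3,4) have "n \<in> {-1..1}" by auto
  then have "n = -1 \<or> n = 0 \<or> n = 1" by auto
  with n assms(3,4) show ?thesis by auto
qed

text \<open>
  The positivity of both radii is what allows the polar angle to be recovered: on a strip wide
  enough to reach the axis the two sides of a ray could not be told apart.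
\<close>

lemma moebius_map_eq_iff:
  assumes p: "(t, v) \<in> square" and q: "(s, w) \<in> square"
  shows "moebius_map (t, v) = moebius_map (s, w) \<longleftrightarrow> ((t, v), (s, w)) \<in> CM_rel"
proof
  assume eq: "moebius_map (t, v) = moebius_map (s, w)"
  let ?r = "1 + t / 2 * cos (v * pi / 2)" and ?r' = "1 + s / 2 * cos (w * pi / 2)"
  have 1: "?r * cos (v * pi) = ?r' * cos (w * pi)"
    and 2: "?r * sin (v * pi) = ?r' * sin (w * pi)"
    and sin: "t * sin (v * pi / 2) = s * sin (w * pi / 2)"
    using eq unfolding moebius_map_def by (simp_all add: vec_eq_iff forall_3)
  note ray = same_ray_imp_eq [OF moebius_radius_pos [OF p] moebius_radius_pos [OF q] 1 2]
  from ray(1) have cos: "t * cos (v * pi / 2) = s * cos (w * pi / 2)" by simp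
  consider "v = w" | "v = 1" "w = -1" | "v = -1" "w = 1"
    using angle_eq_cases [OF ray(2,3)] p q by (auto simp: square_def)
  then show "((t, v), (s, w)) \<in> CM_rel"
  proof cases
    case 1
    \<comment> \<open>Sine and cosine have no common zero, so one of the two equations can be cancelled.\<close>
    have "sin (w * pi / 2) \<noteq> 0 \<or> cos (w * pi / 2) \<noteq> 0"
      using sin_zero_abs_cos_one [of "w * pi / 2"] by auto
    then have "t = s"
      using cos sin 1 by auto
    with 1 p show ?thesis by (auto simp: CM_rel_def)
  qed (use sin p q in \<open>auto simp: CM_rel_def\<close>)
next
  assume "((t, v), (s, w)) \<in> CM_rel"
  then show "moebius_map (t, v) = moebius_map (s, w)"
    by (auto simp: CM_rel_def moebius_map_def)
qed

lemma continuous_on_moebius_map: "continuous_on S moebius_map"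
proof -
  have "continuous_on S (\<lambda>x. moebius_map x $ i)" for i
  proof -
    consider "i = 1" | "i = 2" | "i = 3" using exhaust_3 by blast
    then show ?thesis
      by cases (simp_all add: moebius_map_def case_prod_unfold, (intro continuous_intros; simp)+)
  qed
  then show ?thesis
    using continuous_on_vec_lambda [of S "\<lambda>i x. moebius_map x $ i"] by simp
qed

lemma quotient_map_moebius_map:
  "quotient_map (top_of_set square) (top_of_set moebius_surface) moebius_map"
proof (rule T1_Spaces.continuous_imp_quotient_map)
  show "continuous_map (top_of_set square) (top_of_set moebius_surface) moebius_map"
    by (auto simp: moebius_surface_def continuous_on_moebius_map)
  show "compact_space (top_of_set square)"
    by (simp add: square_def compact_Times compact_space_subtopology)
  show "Hausdorff_space (top_of_set moebius_surface)"
    by (simp add: Hausdorff_space_subtopology)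
qed (simp add: moebius_surface_def)

theorem mainTheorem1:
  shows "C_M homeomorphic_space top_of_set moebius_surface"
  unfolding C_M_def
proof (rule homeomorphic_space_quotient_maps_same_fibres
    [OF quotient_map_quotient_topology quotient_map_moebius_map])
  fix x y
  assume "x \<in> topspace (top_of_set square)" "y \<in> topspace (top_of_set square)"
  then show "CM_rel `` {x} = CM_rel `` {y} \<longleftrightarrow> moebius_map x = moebius_map y"
    using moebius_map_eq_iff eq_equiv_class_iff [OF equiv_CM_rel]
    by (cases x, cases y) simp
qed

end
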